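(* Let $(\mathcal{X},d_{\mathcal{X}})$ be a compact metric space, $(\mathcal{Y},d_{\mathcal{Y}})$ a metric space, and $f\colon\mathcal{X}\to\mathcal{Y}$ continuous. Let $t>0$ be fixed, let $0<r\leq t$, and let $X_N=\{x_1,\ldots,x_N\}\subset\mathcal{X}$ with $N\geq\mathcal{N}(\mathcal{X},r/2)$ be an $r/2$-net, that is, $\bigcup_{n=1}^N B_{r/2}(x_n)=\mathcal{X}$. Then $$0\leq\omega(f,t)-\omega_N(f,t)\leq\omega(f,t)-\omega(f,t-r)+2\,\omega(f,r).$$
   Context: $B_\varepsilon(x')=\{x\in\mathcal{X}: d_{\mathcal{X}}(x,x')\leq\varepsilon\}$ denotes the closed ball. An $\varepsilon$-net for $\mathcal{X}$ is a subset $\mathcal{K}\subset\mathcal{X}$ such that each $x\in\mathcal{X}$ lies in $B_\varepsilon(x')$ for some $x'\in\mathcal{K}$; the covering number $\mathcal{N}(\mathcal{X},\varepsilon)$ is the smallest cardinality of an $\varepsilon$-net for $\mathcal{X}$. The modulus of continuity of $f\colon\mathcal{X}\to\mathcal{Y}$ is $\omega(f,t)=\sup\{d_{\mathcal{Y}}(f(x),f(x')): x,x'\in\mathcal{X},\ d_{\mathcal{X}}(x,x')\leq t\}$ for $t\in[0,\infty]$. The discrete modulus of continuity with respect to the finite set $X_N$ is $\omega_N(f,t)=\max\{d_{\mathcal{Y}}(f(x_i),f(x_j)): x_i,x_j\in X_N,\ d_{\mathcal{X}}(x_i,x_j)\leq t\}$. *)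

theory Defs
  imports "HOL-Analysis.Analysis"
begin

text \<open>
  Metric spaces are carrier sets \<open>X\<close> in a type of class \<^class>\<open>metric_space\<close>. The closed ball of
  radius \<open>\<epsilon>\<close> around \<open>x' \<in> X\<close> within \<open>X\<close> is \<open>cball x' \<epsilon> \<inter> X\<close>.
\<close>

definition is_net :: "'a::metric_space set \<Rightarrow> real \<Rightarrow> 'a set \<Rightarrow> bool" where
  "is_net X \<epsilon> K \<longleftrightarrow> K \<subseteq> X \<and> (\<forall>x\<in>X. \<exists>x'\<in>K. x \<in> cball x' \<epsilon> \<inter> X)"

text \<open>The infimum is a minimum by well-foundedness, and is \<open>\<infinity>\<close> if there is no finite net.\<close>

definition covering_number :: "'a::metric_space set \<Rightarrow> real \<Rightarrow> enat" where
  "covering_number X \<epsilon> = (INF K \<in> {K. finite K \<and> is_net X \<epsilon> K}. enat (card K))"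

text \<open>
  The scale \<open>t\<close> ranges over \<open>[0,\<infinity>]\<close>. For nonempty \<open>X\<close> and \<open>t \<ge> 0\<close> the supremum (maximum) is over
  a nonempty set; the empty space gets the value 0, as in \<^const>\<open>diameter\<close>. The supremum is taken
  in the reals, which is meaningful if \<open>f\<close> is bounded on \<open>X\<close>, in particular if \<open>X\<close> is compact and
  \<open>f\<close> continuous; see \<open>bdd_above_modulus\<close> below.
\<close>

definition modulus_of_continuity ::
  "'a::metric_space set \<Rightarrow> ('a \<Rightarrow> 'b::metric_space) \<Rightarrow> ereal \<Rightarrow> real" where
  "modulus_of_continuity X f t =
     (if X = {} then 0
      else Sup {dist (f x) (f x') | x x'. x \<in> X \<and> x' \<in> X \<and> ereal (dist x x') \<le> t})"

definition discrete_modulus_of_continuity ::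
  "'a::metric_space set \<Rightarrow> ('a \<Rightarrow> 'b::metric_space) \<Rightarrow> ereal \<Rightarrow> real" where
  "discrete_modulus_of_continuity XN f t =
     (if XN = {} then 0
      else Max {dist (f x) (f x') | x x'. x \<in> XN \<and> x' \<in> XN \<and> ereal (dist x x') \<le> t})"

lemma bdd_above_modulus:
  fixes f :: "'a::metric_space \<Rightarrow> 'b::metric_space"
  assumes "compact X" and "continuous_on X f"
  shows "bdd_above {dist (f x) (f x') | x x'. x \<in> X \<and> x' \<in> X \<and> ereal (dist x x') \<le> t}"
proof -
  have "bounded (f ` X)"
    using assms by (intro compact_imp_bounded compact_continuous_image)
  then show ?thesis
    using diameter_bounded_bound[of "f ` X"] by (intro bdd_aboveI[of _ "diameter (f ` X)"]) auto
qed

end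

theory Submission
  imports Defs
begin

text \<open>
  If \<open>d(u, v) \<le> t - r\<close>, replace \<open>u\<close> and \<open>v\<close> by net points \<open>a\<close> and \<open>b\<close> at distance at most \<open>r/2\<close>.
  Then \<open>d(a, b) \<le> t\<close>, and the triangle inequality in the target gives
  \<open>d(f(u), f(v)) \<le> \<omega>\<^sub>N(f, t) + 2 \<omega>(f, r)\<close>.
\<close>

text \<open>A real supremum dominates its members only when they are bounded above; compactness and
  continuity enter here to guarantee that.\<close>

lemma dist_le_modulus_of_continuity:
  fixes f :: "'a::metric_space \<Rightarrow> 'b::metric_space"
  assumes "compact X" "continuous_on X f" "u \<in> X" "v \<in> X" "ereal (dist u v) \<le> t"
  shows "dist (f u) (f v) \<le> modulus_of_continuity X f t"
  using assms unfolding modulus_of_continuity_def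
  by (auto intro!: cSup_upper bdd_above_modulus)

text \<open>The sign conditions cover degenerate cases: \<open>0 \<le> t\<close> admits the diagonal
  pairs, so the supremum runs over a nonempty set, and \<open>0 \<le> c\<close> handles the empty
  space, whose modulus is 0 by convention.\<close>

lemma modulus_of_continuity_le:
  fixes f :: "'a::metric_space \<Rightarrow> 'b::metric_space"
  assumes "0 \<le> t" "0 \<le> c"
    and "\<And>u v. u \<in> X \<Longrightarrow> v \<in> X \<Longrightarrow> ereal (dist u v) \<le> t \<Longrightarrow> dist (f u) (f v) \<le> c"
  shows "modulus_of_continuity X f t \<le> c"
proof (cases "X = {}")
  case True
  then show ?thesis
    using assms(2) by (simp add: modulus_of_continuity_def)
next
  case False
  then obtain u where "u \<in> X" by blast
  then have "dist (f u) (f u) \<in> {dist (f u) (f v) | u v. u \<in> X \<and> v \<in> X \<and> ereal (dist u v) \<le> t}"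
    using assms(1) by (intro CollectI exI[of _ u]) (simp add: zero_ereal_def[symmetric])
  then show ?thesis
    using False assms(3) unfolding modulus_of_continuity_def
    by (auto intro!: cSup_least)
qed

lemma modulus_of_continuity_nonneg:
  fixes f :: "'a::metric_space \<Rightarrow> 'b::metric_space"
  assumes "compact X" "continuous_on X f" "0 \<le> t"
  shows "0 \<le> modulus_of_continuity X f t"
proof (cases "X = {}")
  case True
  then show ?thesis
    by (simp add: modulus_of_continuity_def)
next
  case False
  then obtain u where "u \<in> X" by blast
  then show ?thesis
    using dist_le_modulus_of_continuity[OF assms(1,2), of u u t] assms(3)
    by (simp add: zero_ereal_def[symmetric])
qed

text \<open>This lets the net be treated as a compact space of its own, so that the estimates for
  \<open>modulus_of_continuity\<close> apply to it. Finitely many pairs give finitely many values,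
  and the diagonal gives at least one.\<close>

lemma discrete_modulus_of_continuity_eq:
  fixes f :: "'a::metric_space \<Rightarrow> 'b::metric_space"
  assumes "finite K" "0 \<le> t"
  shows "discrete_modulus_of_continuity K f t = modulus_of_continuity K f t"
proof (cases "K = {}")
  case True
  then show ?thesis
    by (simp add: modulus_of_continuity_def discrete_modulus_of_continuity_def)
next
  case False
  let ?S = "{dist (f u) (f v) | u v. u \<in> K \<and> v \<in> K \<and> ereal (dist u v) \<le> t}"
  have "?S \<subseteq> (\<lambda>(u, v). dist (f u) (f v)) ` (K \<times> K)"
    by auto
  then have "finite ?S"
    using assms(1) by (meson finite_SigmaI finite_imageI finite_subset)
  moreover obtain u where "u \<in> K"
    using False by blast
  then have "dist (f u) (f u) \<in> ?S"
    using assms(2) by (intro CollectI exI[of _ u]) (simp add: zero_ereal_def[symmetric])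
  then have "?S \<noteq> {}"
    by blast
  ultimately have "Sup ?S = Max ?S"
    by (rule cSup_eq_Max)
  then show ?thesis
    using False by (simp add: modulus_of_continuity_def discrete_modulus_of_continuity_def)
qed

lemma modulus_of_continuity_mono:
  fixes f :: "'a::metric_space \<Rightarrow> 'b::metric_space"
  assumes "compact X" "continuous_on X f" "K \<subseteq> X" "0 \<le> s" "s \<le> t"
  shows "modulus_of_continuity K f s \<le> modulus_of_continuity X f t"
  using assms
  by (intro modulus_of_continuity_le)
    (auto intro!: modulus_of_continuity_nonneg dist_le_modulus_of_continuity
      intro: order_trans)

lemma modulus_of_continuity_le_net:
  fixes f :: "'a::metric_space \<Rightarrow> 'b::metric_space"
  assumes X: "compact X" "continuous_on X f"
    and K: "compact K" "is_net X (r / 2) K"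
    and r: "0 < r" "ereal r \<le> t"
  shows "modulus_of_continuity X f (t - ereal r)
    \<le> modulus_of_continuity K f t + 2 * modulus_of_continuity X f r"
proof (rule modulus_of_continuity_le)
  have KX: "K \<subseteq> X"
    using K(2) by (simp add: is_net_def)
  then have Kf: "continuous_on K f"
    using X(2) continuous_on_subset by blast
  have near: "\<exists>a\<in>K. dist a u \<le> r / 2" if "u \<in> X" for u
    using K(2) that by (auto simp: is_net_def)
  \<comment> \<open>The case split separates finite scales from \<infinity>, where the difference is
    again \<infinity>.\<close>
  show "0 \<le> t - ereal r"
    using r(2) by (cases t) auto
  have "0 \<le> ereal r"
    using r(1) by simp
  then have "0 \<le> t"
    using r(2) by (rule order_trans)
  then show "0 \<le> modulus_of_continuity K f t + 2 * modulus_of_continuity X f r"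
    using modulus_of_continuity_nonneg[OF K(1) Kf] modulus_of_continuity_nonneg[OF X]
      \<open>0 \<le> ereal r\<close> by simp
  fix u v
  assume uv: "u \<in> X" "v \<in> X" "ereal (dist u v) \<le> t - ereal r"
  obtain a b where a: "a \<in> K" "dist a u \<le> r / 2" and b: "b \<in> K" "dist b v \<le> r / 2"
    using near uv(1,2) by blast
  have "dist a b \<le> dist a u + dist u v + dist b v"
    by (metis add_mono_thms_linordered_semiring(3) dist_commute dist_triangle order_trans)
  then have "dist a b \<le> dist u v + r"
    using a(2) b(2) by linarith
  \<comment> \<open>For finite \<open>t\<close>, the \<open>r\<close> lost in the two moves of
    length at most \<open>r / 2\<close> is exactly the \<open>r\<close> subtracted from the scale;
    for infinite \<open>t\<close> the bound is trivial.\<close>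
  then have "ereal (dist a b) \<le> t"
    using uv(3) by (cases t) auto
  then have "dist (f a) (f b) \<le> modulus_of_continuity K f t"
    using dist_le_modulus_of_continuity[OF K(1) Kf a(1) b(1)] by blast
  \<comment> \<open>The net point lies within \<open>r / 2\<close>, hence within \<open>r\<close>,
    which is the scale of the error term.\<close>
  moreover have "dist (f a) (f u) \<le> modulus_of_continuity X f r"
    using a uv(1) KX r(1) by (intro dist_le_modulus_of_continuity[OF X]) auto
  moreover have "dist (f b) (f v) \<le> modulus_of_continuity X f r"
    using b uv(2) KX r(1) by (intro dist_le_modulus_of_continuity[OF X]) auto
  moreover have "dist (f u) (f v) \<le> dist (f a) (f u) + dist (f a) (f b) + dist (f b) (f v)"
    using dist_triangle[of "f u" "f v" "f a"] dist_triangle[of "f a" "f v" "f b"]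
    by (simp add: dist_commute)
  ultimately show "dist (f u) (f v)
      \<le> modulus_of_continuity K f t + 2 * modulus_of_continuity X f r"
    by linarith
qed

theorem theorem3p6:
  fixes X :: "'a::metric_space set"
    and f :: "'a \<Rightarrow> 'b::metric_space"
    and t :: ereal and r :: real
    and N :: nat and x :: "nat \<Rightarrow> 'a"
  assumes "compact X"
    and "continuous_on X f"
    and "0 < t"
    and "0 < r" and "ereal r \<le> t"
    and "covering_number X (r / 2) \<le> enat N"
    and "is_net X (r / 2) (x ` {1..N})"
  shows "0 \<le> modulus_of_continuity X f t - discrete_modulus_of_continuity (x ` {1..N}) f t
    \<and> modulus_of_continuity X f t - discrete_modulus_of_continuity (x ` {1..N}) f t
        \<le> modulus_of_continuity X f t - modulus_of_continuity X f (t - ereal r)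
          + 2 * modulus_of_continuity X f r"
proof -
  let ?K = "x ` {1..N}"
  have "discrete_modulus_of_continuity ?K f t = modulus_of_continuity ?K f t"
    using assms(3) by (intro discrete_modulus_of_continuity_eq) auto
  moreover have "modulus_of_continuity ?K f t \<le> modulus_of_continuity X f t"
    using assms(3,7) by (intro modulus_of_continuity_mono[OF assms(1,2)]) (auto simp: is_net_def)
  moreover have "modulus_of_continuity X f (t - ereal r)
      \<le> modulus_of_continuity ?K f t + 2 * modulus_of_continuity X f r"
    using assms(4,5,7)
    by (intro modulus_of_continuity_le_net[OF assms(1,2)]) (auto intro: finite_imp_compact)
  \<comment> \<open>Monotonicity gives the lower bound. In the upper bound \<omega>(f, t) cancels,
    and what remains is the net estimate.\<close>
  ultimately show ?thesis
    by linarith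
qed

end
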